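(* Let $\mathcal{A}=((A_\xi)_{\xi\in I},\mathcal{F})$ be any algebra, let $\eta\in I$ and $J\subseteq I$. If $\mathcal{A}$ is an $\vec e$-Ramsey algebra for some $\vec e\in\Omega^J_\eta$, then $\mathcal{A}$ is an $\vec e\,'$-Ramsey algebra for every $\vec e\,'\in\Omega^J_\eta$.
   Context: An algebra $((A_\xi)_{\xi\in I},\mathcal{F})$ consists of pairwise disjoint nonempty sets $A_\xi$ (phyla) and a family $\mathcal{F}$ of operations, each from a finite product of phyla into a phylum. Orderly terms $\mathrm{OT}(\mathcal{F})$: smallest collection containing $\mathcal{F}$ and all $\mathrm{id}_{A_\xi}$, closed under $f(\bar x_1,\dots,\bar x_k)=g(h_1(\bar x_1),\dots,h_k(\bar x_k))$ for $k$-ary $g\in\mathcal{F}$, orderly terms $h_i$ with codomains matching $g$'s arguments, and consecutive disjoint variable blocks $\bar x_i$. $\vec a\le_\mathcal{F}\vec b$ means there are orderly terms $f_j$ and finite subsequences $\vec b_j$ of $\vec b$ with $\vec a(j)=f_j(\bar b_j)$ for all $j$ and $\vec b_0\ast\vec b_1\ast\cdots$ a subsequence of $\vec b$. A sort is $\vec e\in{}^\omega I$; $\vec a$ is $\vec e$-sorted if $\vec a(n)\in A_{\vec e(n)}$ for all $n$. $\mathrm{FR}^{\vec e}_\mathcal{F}(\vec b)=\{\vec a(0):\vec a\le_\mathcal{F}\vec b,\ \vec a\ \vec e\text{-sorted}\}$. $\mathcal{A}$ is $\vec e$-Ramsey if for every $\vec e$-sorted $\vec b$ and $X\subseteq A_{\vec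 e(0)}$ there is an $\vec e$-sorted $\vec a\le_\mathcal{F}\vec b$ with $\mathrm{FR}^{\vec e}_\mathcal{F}(\vec a)$ contained in or disjoint from $X$. $\Omega$ is the set of sorts in which every occurring index occurs infinitely often; $\Omega^J$ is the set of $\vec e\in\Omega$ whose set of occurring indices is exactly $J$; $\Omega^J_\eta=\{\vec e\in\Omega^J:\vec e(0)=\eta\}$. *)

theory Defs
  imports Main "HOL-Library.FuncSet" "HOL-Library.Disjoint_Sets"
begin

text \<open>
  An algebra is given by an index set \<open>I\<close>, phyla \<open>A \<xi>\<close> for \<open>\<xi> \<in> I\<close>, and a set \<open>F\<close> of operations.
  \<open>Op [\<xi>\<^sub>1, \<dots>, \<xi>\<^sub>k] \<zeta> f\<close> represents a function \<open>A \<xi>\<^sub>1 \<times> \<dots> \<times> A \<xi>\<^sub>k \<rightarrow> A \<zeta>\<close>. The arguments form a list, and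
  \<open>f\<close> is extensional (\<open>undefined\<close> outside its domain), so that equality of operations is equality
  of functions. Nullary operations (\<open>k = 0\<close>) are allowed.
\<close>

datatype ('i, 'a) oper = Op (args: "'i list") (res: 'i) (app: "'a list \<Rightarrow> 'a")

definition oper_dom :: "('i \<Rightarrow> 'a set) \<Rightarrow> ('i, 'a) oper \<Rightarrow> 'a list set" where
  "oper_dom A g = listset (map A (args g))"

definition is_oper :: "'i set \<Rightarrow> ('i \<Rightarrow> 'a set) \<Rightarrow> ('i, 'a) oper \<Rightarrow> bool" where
  "is_oper I A g \<longleftrightarrow> set (args g) \<subseteq> I \<and> res g \<in> I \<and> app g \<in> oper_dom A g \<rightarrow>\<^sub>E A (res g)"

definition algebra :: "'i set \<Rightarrow> ('i \<Rightarrow> 'a set) \<Rightarrow> ('i, 'a) oper set \<Rightarrow> bool" where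
  "algebra I A F \<longleftrightarrow>
     (\<forall>\<xi>\<in>I. A \<xi> \<noteq> {}) \<and> disjoint_family_on A I \<and> (\<forall>g\<in>F. is_oper I A g)"

definition id_oper :: "('i \<Rightarrow> 'a set) \<Rightarrow> 'i \<Rightarrow> ('i, 'a) oper" where
  "id_oper A \<xi> = Op [\<xi>] \<xi> (restrict hd (listset [A \<xi>]))"

text \<open>
  In rule \<open>comp\<close>, \<open>xss\<close> is the list of consecutive blocks of arguments, the \<open>i\<close>-th block being a
  tuple of arguments for the \<open>i\<close>-th term of \<open>hs\<close>.
\<close>

inductive_set OT :: "'i set \<Rightarrow> ('i \<Rightarrow> 'a set) \<Rightarrow> ('i, 'a) oper set \<Rightarrow> ('i, 'a) oper set"
  for I :: "'i set" and A :: "'i \<Rightarrow> 'a set" and F :: "('i, 'a) oper set" where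
  basic: "g \<in> F \<Longrightarrow> g \<in> OT I A F"
| ident: "\<xi> \<in> I \<Longrightarrow> id_oper A \<xi> \<in> OT I A F"
| comp: "\<lbrakk> g \<in> F; \<forall>h\<in>set hs. h \<in> OT I A F; args g = map res hs;
           is_oper I A f; args f = concat (map args hs); res f = res g;
           \<forall>xss. list_all2 (\<lambda>h xs. xs \<in> oper_dom A h) hs xss \<longrightarrow>
             app f (concat xss) = app g (map2 app hs xss) \<rbrakk>
         \<Longrightarrow> f \<in> OT I A F"

text \<open>
  Finite subsequences of \<open>b\<close> are given by their positions: the \<open>j\<close>-th one is \<open>map b (ns j)\<close>.
  Their infinite concatenation is a subsequence of \<open>b\<close> iff the concatenated positions are strictly
  increasing. This is expressed on all initial segments, since the concatenation can be finite if
  nullary terms are used.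
\<close>

definition reduction ::
  "'i set \<Rightarrow> ('i \<Rightarrow> 'a set) \<Rightarrow> ('i, 'a) oper set \<Rightarrow> (nat \<Rightarrow> 'a) \<Rightarrow> (nat \<Rightarrow> 'a) \<Rightarrow> bool" where
  "reduction I A F a b \<longleftrightarrow>
     (\<exists>f ns. (\<forall>j. f j \<in> OT I A F \<and> map b (ns j) \<in> oper_dom A (f j) \<and>
                  a j = app (f j) (map b (ns j))) \<and>
             (\<forall>m. sorted_wrt (<) (concat (map ns [0..<m]))))"

definition has_sort :: "('i \<Rightarrow> 'a set) \<Rightarrow> (nat \<Rightarrow> 'i) \<Rightarrow> (nat \<Rightarrow> 'a) \<Rightarrow> bool" where
  "has_sort A e a \<longleftrightarrow> (\<forall>n. a n \<in> A (e n))"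

definition FR ::
  "'i set \<Rightarrow> ('i \<Rightarrow> 'a set) \<Rightarrow> ('i, 'a) oper set \<Rightarrow> (nat \<Rightarrow> 'i) \<Rightarrow> (nat \<Rightarrow> 'a) \<Rightarrow> 'a set" where
  "FR I A F e b = {a 0 | a. reduction I A F a b \<and> has_sort A e a}"

definition ramsey_algebra ::
  "'i set \<Rightarrow> ('i \<Rightarrow> 'a set) \<Rightarrow> ('i, 'a) oper set \<Rightarrow> (nat \<Rightarrow> 'i) \<Rightarrow> bool" where
  "ramsey_algebra I A F e \<longleftrightarrow>
     (\<forall>b X. has_sort A e b \<and> X \<subseteq> A (e 0) \<longrightarrow>
        (\<exists>a. has_sort A e a \<and> reduction I A F a b \<and>
             (FR I A F e a \<subseteq> X \<or> FR I A F e a \<inter> X = {})))"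

definition Omega :: "'i set \<Rightarrow> (nat \<Rightarrow> 'i) set" where
  "Omega I = {e. range e \<subseteq> I \<and> (\<forall>\<xi>\<in>range e. infinite {n. e n = \<xi>})}"

definition Omega_on :: "'i set \<Rightarrow> 'i set \<Rightarrow> (nat \<Rightarrow> 'i) set" where
  "Omega_on I J = {e \<in> Omega I. range e = J}"

definition Omega_at :: "'i set \<Rightarrow> 'i set \<Rightarrow> 'i \<Rightarrow> (nat \<Rightarrow> 'i) set" where
  "Omega_at I J \<eta> = {e \<in> Omega_on I J. e 0 = \<eta>}"

end

theory Submission
  imports Defs
begin

text \<open>
  Any two sorts in \<open>\<Omega>\<^sup>J\<close> contain each other as subsequences. Given an \<open>e'\<close>-sorted \<open>b\<close>, pass to an
  \<open>e\<close>-sorted subsequence, apply the \<open>e\<close>-Ramsey property to obtain an \<open>a\<close>, and pass to an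
  \<open>e'\<close>-sorted subsequence \<open>a'\<close> of \<open>a\<close>. A member of \<open>FR\<^sup>e\<^sup>'(a')\<close> is the value of a single orderly term on a
  finite part of \<open>a\<close>. Since only the first entry of a reduction matters, the remaining entries can
  be replaced by later entries of \<open>a\<close> of the sort required by \<open>e\<close>, so the value lies in \<open>FR\<^sup>e(a)\<close>.
  Only subsequences are composed with reductions, so closure of orderly terms under
  composition is never needed.
\<close>

text \<open>The pairwise form is easy to check after blocks are dropped or replaced. It compares all
  pairs \<open>i < j\<close>, not just neighbours, because an empty block (from a nullary term)
  would break a chain of neighbouring comparisons.\<close>

lemma sorted_wrt_concat_upt_iff:
  "(\<forall>m. sorted_wrt R (concat (map ns [0..<m]))) \<longleftrightarrow>
     (\<forall>j. sorted_wrt R (ns j)) \<and> (\<forall>i j. i < j \<longrightarrow> (\<forall>x\<in>set (ns i). \<forall>y\<in>set (ns j). R x y))"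
  (is "?L \<longleftrightarrow> ?R")
proof
  assume L: ?L
  have step: "sorted_wrt R (concat (map ns [0..<j]) @ ns j)" for j
    using L[rule_format, of "Suc j"] by simp
  show ?R
    using step by (fastforce simp: sorted_wrt_append)
next
  assume R: ?R
  show ?L
  proof
    fix m
    show "sorted_wrt R (concat (map ns [0..<m]))"
      using R by (induction m) (auto simp: sorted_wrt_append)
  qed
qed

text \<open>Dropping blocks along \<open>s\<close> keeps the rest in order, and pushing positions
  forward along \<open>t\<close> preserves their order.\<close>

lemma reduction_subseq:
  assumes red: "reduction I A F a (b \<circ> t)" and s: "strict_mono s" and t: "strict_mono t"
  shows "reduction I A F (a \<circ> s) b"
proof -
  obtain f ns where f: "\<And>j. f j \<in> OT I A F \<and> map (b \<circ> t) (ns j) \<in> oper_dom A (f j) \<and>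
                              a j = app (f j) (map (b \<circ> t) (ns j))"
    and ns: "\<forall>m. sorted_wrt (<) (concat (map ns [0..<m]))"
    using red unfolding reduction_def by blast
  have "\<forall>m. sorted_wrt (<) (concat (map (\<lambda>j. map t (ns (s j))) [0..<m]))"
    using ns strict_monoD[OF s] unfolding sorted_wrt_concat_upt_iff
    by (auto simp: sorted_wrt_map strict_mono_less[OF t]) blast
  then show ?thesis
    using f unfolding reduction_def
    by (intro exI[of _ "f \<circ> s"] exI[of _ "\<lambda>j. map t (ns (s j))"]) simp
qed

text \<open>Each index occurs in \<open>e'\<close> beyond any bound, so positions can be chosen
  greedily. The bound \<open>n\<close> allows starting after a given finite block;
  \<open>e = e'\<close> is then a useful case.\<close>

lemma Omega_on_subseq:
  assumes "e \<in> Omega_on I J" and "e' \<in> Omega_on I J"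
  obtains s :: "nat \<Rightarrow> nat" where "strict_mono s" and "\<And>k. e' (s k) = e k" and "\<And>k. n < s k"
proof -
  have ex: "\<exists>m>l. e' m = e k" for l k
  proof -
    have "e k \<in> range e'"
      using assms by (auto simp: Omega_on_def)
    then have "infinite {m. e' m = e k}"
      using assms(2) by (auto simp: Omega_on_def Omega_def)
    then show ?thesis
      by (auto simp: finite_nat_set_iff_bounded_le not_le)
  qed
  have "\<exists>s. \<forall>k. (e' (s k) = e k \<and> n < s k) \<and> s k < s (Suc k)"
  proof (rule dependent_nat_choice)
    show "\<exists>x. e' x = e 0 \<and> n < x"
      using ex[of n 0] by blast
    show "\<exists>y. (e' y = e (Suc k) \<and> n < y) \<and> x < y" if "e' x = e k \<and> n < x" for x k
      using ex[of x "Suc k"] that by (meson less_trans)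
  qed
  then show thesis
    using that by (auto simp: strict_mono_Suc_iff)
qed

lemma has_sort_subseq:
  assumes "has_sort A e a" and "\<And>k. e (s k) = e' k"
  shows "has_sort A e' (a \<circ> s)"
  using assms by (metis comp_apply has_sort_def)

lemma replace_tail_reduction:
  assumes red: "reduction I A F c a" and e: "e \<in> Omega_on I J"
    and a: "has_sort A e a" and c0: "c 0 \<in> A (e 0)"
  obtains d where "reduction I A F d a" and "has_sort A e d" and "d 0 = c 0"
proof -
  obtain f ns where f: "\<And>j. f j \<in> OT I A F \<and> map a (ns j) \<in> oper_dom A (f j) \<and>
                              c j = app (f j) (map a (ns j))"
    and ns: "\<forall>m. sorted_wrt (<) (concat (map ns [0..<m]))"
    using red unfolding reduction_def by blast
  \<comment> \<open>A copy of \<open>e\<close> inside itself, past all positions used by the first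
    term; inserting 0 keeps \<open>Max\<close> meaningful when \<open>ns 0\<close> is empty.\<close>
  obtain s :: "nat \<Rightarrow> nat"
    where s: "strict_mono s" "\<And>k. e (s k) = e k" "\<And>k. Max (insert 0 (set (ns 0))) < s k"
    using Omega_on_subseq[OF e e] by blast
  have gt: "x < s k" if "x \<in> set (ns 0)" for x k
    using s(3)[of k] that by (simp add: Max_gr_iff[symmetric])
  have as: "a (s k) \<in> A (e k)" for k
    using a s(2) by (metis has_sort_def)
  define d where "d k = (if k = 0 then c 0 else a (s k))" for k
  define g where "g k = (if k = 0 then f 0 else id_oper A (e k))" for k
  define ms where "ms k = (if k = 0 then ns 0 else [s k])" for k
  have "g j \<in> OT I A F \<and> map a (ms j) \<in> oper_dom A (g j) \<and> d j = app (g j) (map a (ms j))" for j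
  proof (cases "j = 0")
    case True
    then show ?thesis
      using f[of 0] by (simp add: g_def d_def ms_def)
  next
    case False
    have "e j \<in> I"
      using e by (auto simp: Omega_on_def Omega_def)
    then have "id_oper A (e j) \<in> OT I A F"
      by (rule OT.ident)
    then show ?thesis
      using False as[of j]
      by (simp add: g_def d_def ms_def) (simp add: id_oper_def oper_dom_def set_Cons_def)
  qed
  moreover have "\<forall>m. sorted_wrt (<) (concat (map ms [0..<m]))"
    using ns gt s(1) unfolding sorted_wrt_concat_upt_iff
    by (auto simp: ms_def strict_mono_less)
  ultimately have "reduction I A F d a"
    unfolding reduction_def by blast
  moreover have "has_sort A e d"
    using as c0 by (simp add: has_sort_def d_def)
  ultimately show thesis
    using that by (simp add: d_def)
qed

lemma FR_subseq_subset:
  assumes e: "e \<in> Omega_on I J" and e0: "e' 0 = e 0" and a: "has_sort A e a"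
    and s: "strict_mono s"
  shows "FR I A F e' (a \<circ> s) \<subseteq> FR I A F e a"
proof
  fix x
  assume "x \<in> FR I A F e' (a \<circ> s)"
  then obtain c where c: "x = c 0" "reduction I A F c (a \<circ> s)" "has_sort A e' c"
    by (auto simp: FR_def)
  have "reduction I A F c a"
    using reduction_subseq[OF c(2) _ s, of id] by (simp add: strict_mono_def)
  \<comment> \<open>The later entries of \<open>c\<close> may have the wrong sort for
    \<open>e\<close>; at index 0 the two sorts agree.\<close>
  moreover have "c 0 \<in> A (e 0)"
    using c(3) e0 by (metis has_sort_def)
  ultimately obtain d where "reduction I A F d a" "has_sort A e d" "d 0 = c 0"
    using replace_tail_reduction e a by metis
  then show "x \<in> FR I A F e a"
    using c(1) by (auto simp: FR_def intro!: exI[of _ d])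
qed

lemma ramsey_algebra_transfer:
  assumes e: "e \<in> Omega_on I J" and e': "e' \<in> Omega_on I J" and e0: "e' 0 = e 0"
    and ramsey: "ramsey_algebra I A F e"
  shows "ramsey_algebra I A F e'"
  unfolding ramsey_algebra_def
proof (intro allI impI, elim conjE)
  fix b X
  assume b: "has_sort A e' b" and X: "X \<subseteq> A (e' 0)"
  \<comment> \<open>\<open>t\<close> turns \<open>e'\<close>-sorted sequences into
    \<open>e\<close>-sorted ones, and \<open>s\<close> below goes back.\<close>
  obtain t :: "nat \<Rightarrow> nat" where t: "strict_mono t" "\<And>k. e' (t k) = e k"
    using Omega_on_subseq[OF e e'] by metis
  obtain s :: "nat \<Rightarrow> nat" where s: "strict_mono s" "\<And>k. e (s k) = e' k"
    using Omega_on_subseq[OF e' e] by metis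
  have "has_sort A e (b \<circ> t)"
    using has_sort_subseq b t(2) by metis
  then obtain a where a: "has_sort A e a" "reduction I A F a (b \<circ> t)"
      "FR I A F e a \<subseteq> X \<or> FR I A F e a \<inter> X = {}"
    using ramsey X e0 unfolding ramsey_algebra_def by metis
  have "has_sort A e' (a \<circ> s)"
    using has_sort_subseq a(1) s(2) by metis
  moreover have "reduction I A F (a \<circ> s) b"
    using reduction_subseq a(2) s(1) t(1) .
  moreover have "FR I A F e' (a \<circ> s) \<subseteq> FR I A F e a"
    using FR_subseq_subset e e0 a(1) s(1) .
  ultimately show "\<exists>a. has_sort A e' a \<and> reduction I A F a b \<and>
      (FR I A F e' a \<subseteq> X \<or> FR I A F e' a \<inter> X = {})"
    using a(3) by blast
qed

theorem theorem5p7: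
  fixes I J :: "'i set" and A :: "'i \<Rightarrow> 'a set" and F :: "('i, 'a) oper set" and \<eta> :: 'i
  assumes "algebra I A F" and "\<eta> \<in> I" and "J \<subseteq> I"
    and "\<exists>e\<in>Omega_at I J \<eta>. ramsey_algebra I A F e"
  shows "\<forall>e'\<in>Omega_at I J \<eta>. ramsey_algebra I A F e'"
  using assms(4) ramsey_algebra_transfer by (fastforce simp: Omega_at_def)

end
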